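(* Let $\mathcal{A}$ be a union-closed family with base set $\bigcup_{A\in\mathcal{A}}A=[n]$. Then for every $x \in \left[\lceil \tfrac{n}{3}\rceil + 1\right]$ there exists a subset $B \subseteq [n]$ with $|B| = n-x+1$ such that $|\mathcal{A}_B| \geq |\mathcal{A}_{\underline{B}}|$.
   Context: For a positive integer $m$, $[m]=\{1,2,\dots,m\}$. A family of sets $\mathcal{A}$ is union-closed if it is a finite nonempty collection of distinct finite sets, at least one of which is nonempty, such that $X,Y\in\mathcal{A}$ implies $X\cup Y\in\mathcal{A}$. The base set of $\mathcal{A}$ is $\bigcup_{A\in\mathcal{A}}A$, and it is taken to be $[n]$ (so $n\ge 1$). For a set $B\subseteq[n]$, $\mathcal{A}_B=\{A\in\mathcal{A} : A\cap B=B\}$ and $\mathcal{A}_{\underline{B}}=\{A\in\mathcal{A} : A\cap B=\emptyset\}$. *)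

theory Defs
  imports Complex_Main
begin

definition union_closed_family :: "'a set set \<Rightarrow> bool" where
  "union_closed_family \<A> \<longleftrightarrow>
     finite \<A> \<and> \<A> \<noteq> {} \<and> (\<forall>X\<in>\<A>. finite X) \<and> (\<exists>X\<in>\<A>. X \<noteq> {}) \<and>
     (\<forall>X\<in>\<A>. \<forall>Y\<in>\<A>. X \<union> Y \<in> \<A>)"

definition members_containing :: "'a set set \<Rightarrow> 'a set \<Rightarrow> 'a set set" where
  "members_containing \<A> B = {A \<in> \<A>. A \<inter> B = B}"

definition members_avoiding :: "'a set set \<Rightarrow> 'a set \<Rightarrow> 'a set set" where
  "members_avoiding \<A> B = {A \<in> \<A>. A \<inter> B = {}}"

end

theory Submission
  imports Defs
begin

text \<open>
  Put \<open>k = x - 1\<close> and let \<open>B\<close> be the complement of a \<open>k\<close>-set \<open>C\<close>. If some \<open>C\<close> contains no nonempty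
  member, then the only set that can avoid \<open>B\<close> is the empty one, while the base set contains \<open>B\<close>. If
  some \<open>B\<close> is itself a member, then \<open>A \<mapsto> A \<union> B\<close> is injective on the sets avoiding \<open>B\<close>. One of the
  two always happens: if the first fails, let \<open>I\<close> be a maximal set without nonempty members inside it; then
  \<open>|I| < k\<close>, and every \<open>v \<notin> I\<close> lies in a member \<open>F v \<subseteq> I \<union> {v}\<close>. At most \<open>|I|\<close> of the sets \<open>F v\<close>
  suffice to absorb all elements of \<open>I\<close> that occur in them, giving a union of size at most
  \<open>2 |I| \<le> 2 k - 2 \<le> n - k\<close>. From there on each further \<open>F v\<close> adds the single element \<open>v\<close>, so the
  sizes grow in steps of one up to at least \<open>n - |I|\<close>, passing through \<open>n - k\<close>.
\<close>

lemma exists_member_of_complementary_card: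
  assumes "finite E" and sub: "\<And>A. A \<in> \<A> \<Longrightarrow> A \<subseteq> E"
    and empty: "{} \<in> \<A>" and Un: "\<And>X Y. X \<in> \<A> \<Longrightarrow> Y \<in> \<A> \<Longrightarrow> X \<union> Y \<in> \<A>"
    and k: "3 * k \<le> card E + 2"
    and hit: "\<And>C. C \<subseteq> E \<Longrightarrow> card C = k \<Longrightarrow> \<exists>A\<in>\<A>. A \<noteq> {} \<and> A \<subseteq> C"
  obtains B where "B \<in> \<A>" "card B = card E - k"
proof -
  let ?free = "\<lambda>I. I \<subseteq> E \<and> (\<forall>A\<in>\<A>. A \<subseteq> I \<longrightarrow> A = {})"
  let ?S = "{I. ?free I}"
  have "finite ?S"
    using \<open>finite E\<close> by (auto intro: finite_subset[of _ "Pow E"])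
  moreover have "?S \<noteq> {}" using bot.extremum subset_empty by blast
  ultimately obtain I where "I \<in> ?S" and maximal: "\<forall>J\<in>?S. I \<subseteq> J \<longrightarrow> I = J"
    by (rule finite_has_maximal[THEN bexE])
  then have I: "?free I" by simp
  have max: "I = J" if "?free J" "I \<subseteq> J" for J
    using maximal that by simp
  have fin_sub: "finite X" if "X \<subseteq> E" for X
    using that \<open>finite E\<close> by (rule finite_subset)
  have card_I: "card I < k"
  proof (rule ccontr)
    assume "\<not> card I < k"
    then obtain C where "C \<subseteq> I" "card C = k"
      by (meson not_less obtain_subset_with_card_n)
    then show False using hit[of C] I by blast
  qed
  have "\<exists>A\<in>\<A>. v \<in> A \<and> A \<subseteq> insert v I" if "v \<in> E - I" for v
  proof (rule ccontr)
    assume no: "\<not> ?thesis"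
    have "?free (insert v I)"
      using that I no by blast
    then show False using max[of "insert v I"] that by blast
  qed
  then obtain F where F: "\<And>v. v \<in> E - I \<Longrightarrow> F v \<in> \<A> \<and> v \<in> F v \<and> F v \<subseteq> insert v I"
    by metis
  \<comment> \<open>\<open>?P\<close> holds for unions of sets \<open>F v\<close> each of which absorbs a new element of \<open>I\<close>;
    maximality of \<open>|Y \<inter> I|\<close> means that no further \<open>F v\<close> does so.\<close>
  let ?P = "\<lambda>Y. Y \<in> \<A> \<and> card Y \<le> 2 * card (Y \<inter> I)"
  have "\<forall>Y. ?P Y \<longrightarrow> card (Y \<inter> I) < Suc (card E)"
    by (meson sub card_mono le_imp_less_Suc \<open>finite E\<close> inf.coboundedI1)
  moreover have "?P {}" using empty by simp
  ultimately have "\<exists>Y. ?P Y \<and> (\<forall>Z. ?P Z \<longrightarrow> card (Z \<inter> I) \<le> card (Y \<inter> I))"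
    by (rule ex_has_greatest_nat[of ?P "{}" "\<lambda>Y. card (Y \<inter> I)", rotated])
  then obtain Y where Y: "?P Y"
    and Y_max: "\<And>Z. ?P Z \<Longrightarrow> card (Z \<inter> I) \<le> card (Y \<inter> I)"
    by (elim exE conjE) simp
  have fin: "finite Y" "finite I" using Y I sub fin_sub by auto
  have saturated: "F v \<subseteq> insert v Y" if v: "v \<in> E - I - Y" for v
  proof (rule ccontr)
    assume "\<not> ?thesis"
    then have ne: "F v \<inter> I - Y \<noteq> {}" using F[of v] v by blast
    let ?D = "F v \<inter> I - Y"
    \<comment> \<open>As \<open>?D\<close> is nonempty, the union gains at most 1 + |D| \<le> 2 |D|
      elements, so \<open>?P\<close> persists while the part in \<open>I\<close> grows.\<close>
    have "Y \<union> F v = insert v (Y \<union> ?D)" and Z: "(Y \<union> F v) \<inter> I = (Y \<inter> I) \<union> ?D"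
      using F[of v] v by blast+
    then have "card (Y \<union> F v) \<le> Suc (card Y + card ?D)"
      using card_Un_le[of Y ?D] card_insert_le_m1[of "Suc (card Y + card ?D)" "Y \<union> ?D" v] by simp
    moreover have "card ((Y \<union> F v) \<inter> I) = card (Y \<inter> I) + card ?D"
      unfolding Z using fin by (intro card_Un_disjoint) auto
    moreover have "card ?D > 0" using ne fin by (simp add: card_gt_0_iff)
    moreover have "Y \<union> F v \<in> \<A>" using Un Y F[of v] v by blast
    ultimately show False using Y_max[of "Y \<union> F v"] Y by linarith
  qed
  have extend: "Y \<union> V \<in> \<A>" if "finite V" "V \<subseteq> E - I - Y" for V
    using that
  proof (induction V)
    case empty
    then show ?case using Y by simp
  next
    case (insert v V)
    then have "Y \<union> insert v V = (Y \<union> V) \<union> F v"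
      using saturated[of v] F[of v] by blast
    then show ?case using insert Un F[of v] by auto
  qed
  have "card (Y \<inter> I) \<le> card I" using fin by (simp add: card_mono)
  \<comment> \<open>Here |Y| \<le> 2 |I| \<le> 2 (k - 1), and the bound on 3 k makes this at most
    |E| - k.\<close>
  then have small: "card Y \<le> card E - k" using Y k card_I by linarith
  have "card (E - I - Y) \<ge> card E - card I - card Y"
    using fin diff_card_le_card_Diff[of I E] diff_card_le_card_Diff[of Y "E - I"] by linarith
  then have "card E - k - card Y \<le> card (E - I - Y)"
    using card_I by linarith
  then obtain V where V: "V \<subseteq> E - I - Y" "card V = card E - k - card Y"
    by (meson obtain_subset_with_card_n)
  have "finite V" using V fin_sub by blast
  moreover have "card (Y \<union> V) = card E - k"
    using V small fin \<open>finite V\<close> by (subst card_Un_disjoint) auto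
  ultimately show thesis using that extend V by blast
qed

theorem theorem2p1:
  fixes \<A> :: "nat set set" and n :: nat
  assumes "union_closed_family \<A>"
    and "(\<Union>A\<in>\<A>. A) = {1..n}"
  shows "\<forall>x\<in>{1..nat \<lceil>real n / 3\<rceil> + 1}. \<exists>B\<subseteq>{1..n}.
           int (card B) = int n - int x + 1 \<and>
           card (members_containing \<A> B) \<ge> card (members_avoiding \<A> B)"
proof
  fix x assume x: "x \<in> {1..nat \<lceil>real n / 3\<rceil> + 1}"
  define k where "k = x - 1"
  have fin: "finite \<A>" and ne: "\<A> \<noteq> {}" and ex: "\<exists>X\<in>\<A>. X \<noteq> {}"
    and Un: "\<And>X Y. X \<in> \<A> \<Longrightarrow> Y \<in> \<A> \<Longrightarrow> X \<union> Y \<in> \<A>"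
    using assms(1) by (auto simp: union_closed_family_def)
  have sub: "A \<subseteq> {1..n}" if "A \<in> \<A>" for A using assms(2) that by blast
  have n: "n \<ge> 1" using ex sub by fastforce
  have "int k \<le> \<lceil>real n / 3\<rceil>" using x unfolding k_def by simp linarith
  \<comment> \<open>For an integer n, the ceiling of n/3 is at most (n + 2)/3.\<close>
  then have k3: "3 * k \<le> n + 2" by linarith
  then have kn: "k \<le> n" using n by linarith
  have card_eq: "int (n - k) = int n - int x + 1" using x kn by (auto simp: k_def)
  have "\<Union>\<G> \<in> \<A>" if "finite \<G>" "\<G> \<noteq> {}" "\<G> \<subseteq> \<A>" for \<G>
    using that by (induction rule: finite_ne_induct) (auto intro: Un)
  from this[OF fin ne] have top: "{1..n} \<in> \<A>" using assms(2) by simp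
  have fin_mem: "finite (members_containing \<A> B)" for B
    using fin by (simp add: members_containing_def)
  show "\<exists>B\<subseteq>{1..n}. int (card B) = int n - int x + 1 \<and>
           card (members_containing \<A> B) \<ge> card (members_avoiding \<A> B)"
  proof (cases "\<exists>C\<subseteq>{1..n}. card C = k \<and> (\<forall>A\<in>\<A>. A \<subseteq> C \<longrightarrow> A = {})")
    case True
    then obtain C where C: "C \<subseteq> {1..n}" "card C = k" "\<forall>A\<in>\<A>. A \<subseteq> C \<longrightarrow> A = {}" by blast
    let ?B = "{1..n} - C"
    have "members_avoiding \<A> ?B \<subseteq> {{}}"
    proof
      fix A assume A: "A \<in> members_avoiding \<A> ?B"
      then have "A \<in> \<A>" "A \<subseteq> C"
        using sub[of A] by (auto simp: members_avoiding_def)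
      then show "A \<in> {{}}" using C(3) by blast
    qed
    then have "card (members_avoiding \<A> ?B) \<le> 1"
      using card_mono[of "{{}}" "members_avoiding \<A> ?B"] by simp
    moreover have "{1..n} \<in> members_containing \<A> ?B"
      using top by (auto simp: members_containing_def)
    then have "card (members_containing \<A> ?B) > 0"
      using fin_mem[of ?B] by (auto simp: card_gt_0_iff)
    ultimately have "card (members_avoiding \<A> ?B) \<le> card (members_containing \<A> ?B)"
      by linarith
    moreover have "card ?B = n - k"
      using C by (simp add: card_Diff_subset finite_subset)
    ultimately show ?thesis using card_eq by (intro exI[of _ ?B]) auto
  next
    case False
    \<comment> \<open>The empty set is added because for \<open>n = k = 1\<close> the set \<open>B\<close> is empty and need not be a member.\<close>
    obtain B where B: "B \<in> insert {} \<A>" "card B = card {1..n} - k"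
    proof (rule exists_member_of_complementary_card[of "{1..n}" "insert {} \<A>" k])
      show "\<exists>A\<in>insert {} \<A>. A \<noteq> {} \<and> A \<subseteq> C" if "C \<subseteq> {1..n}" "card C = k" for C
        using False that by blast
    qed (use sub Un k3 in auto)
    have "card (members_avoiding \<A> B) \<le> card (members_containing \<A> B)"
    proof (rule card_inj_on_le)
      show "inj_on (\<lambda>A. A \<union> B) (members_avoiding \<A> B)"
        by (rule inj_onI) (auto simp: members_avoiding_def)
      \<comment> \<open>If \<open>B\<close> is the added empty set, the map is the identity and
        stays in \<open>\<A>\<close>.\<close>
      show "(\<lambda>A. A \<union> B) ` members_avoiding \<A> B \<subseteq> members_containing \<A> B"
        using B Un by (auto simp: members_avoiding_def members_containing_def)
    qed (rule fin_mem)
    then show ?thesis using B sub card_eq by (intro exI[of _ B]) auto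
  qed
qed

end
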